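(* Let $\mathcal{H}$ be a separable Hilbert space and let $A\in\mathcal{L}(\mathcal{H})$ be non-compact. Then for each $B\in\mathcal{L}(\mathcal{H})$ the set of all solutions $\{(X,Y)\in\mathcal{L}(\mathcal{H})\times\mathcal{L}(\mathcal{H}): XAY=B\}$ is dense in $\mathcal{L}(\mathcal{H})\times\mathcal{L}(\mathcal{H})$ with respect to the product of the strong operator topologies.
   Context: $\mathcal{L}(\mathcal{H})$ is the space of bounded linear operators on $\mathcal{H}$. *)

theory Defs
  imports "HOL-Analysis.Analysis"
begin

text \<open>
  Hilbert spaces over \<open>\<real>\<close> and over \<open>\<complex>\<close> are treated simultaneously.  The class below is the
  class of scalar fields; its only models are \<open>\<real>\<close> with the identity and \<open>\<complex>\<close> with complex
  conjugation (see \<open>real_complex_cases\<close> and the two instances).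
\<close>

class real_complex_field = real_normed_field +
  fixes conj :: "'a \<Rightarrow> 'a"
  assumes conj_add: "conj (z + w) = conj z + conj w"
    and mult_conj_scaleR: "z * conj z = (norm z)\<^sup>2 *\<^sub>R 1"

lemma mult_conj: "z * conj z = of_real ((norm z)\<^sup>2)" for z :: "'k::real_complex_field"
  by (simp only: mult_conj_scaleR of_real_def)

instantiation real :: real_complex_field
begin
definition conj_real :: "real \<Rightarrow> real" where "conj_real z = z"
instance by standard (simp_all add: conj_real_def power2_eq_square)
end

instantiation complex :: real_complex_field
begin
definition conj_complex :: "complex \<Rightarrow> complex" where "conj_complex z = cnj z"
instance by standard (simp_all only: conj_complex_def complex_cnj_add complex_norm_square of_real_def[symmetric])
end

lemma conj_of_real: "conj (of_real r :: 'k::real_complex_field) = of_real r"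
proof (cases "r = 0")
  case True
  have "conj (0::'k) + conj 0 = conj 0" using conj_add[of "0::'k" 0] by simp
  with True show ?thesis by simp
next
  case False
  have "of_real r * conj (of_real r :: 'k) = of_real r * of_real r"
    using mult_conj[of "of_real r :: 'k"] by (simp add: power2_eq_square flip: of_real_mult)
  with False show ?thesis by simp
qed

lemma add_conj_real: "\<exists>r. (z::'k::real_complex_field) + conj z = of_real r"
proof -
  have "(z + 1) * (conj z + 1) = of_real ((norm (z + 1))\<^sup>2)"
    using mult_conj[of "z + 1"] conj_of_real[of 1, where 'k='k] by (simp add: conj_add)
  then have "z + conj z = of_real ((norm (z + 1))\<^sup>2 - (norm z)\<^sup>2 - 1)"
    by (simp add: algebra_simps mult_conj)
  then show ?thesis by blast
qed

lemma real_complex_cases: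
  "(\<forall>z::'k::real_complex_field. z \<in> \<real>) \<or>
   (\<exists>i::'k. i * i = -1 \<and> (\<forall>z. \<exists>a b. z = of_real a + of_real b * i))"
proof (cases "\<forall>z::'k. z \<in> \<real>")
  case False
  have root: "\<exists>a b. (z - of_real a) * (z - of_real a) = (of_real b :: 'k)" for z
  proof -
    obtain r where r: "z + conj z = of_real r" using add_conj_real by blast
    then have c: "conj z = of_real r - z" by (simp add: algebra_simps)
    have "z * (of_real r - z) = of_real ((norm z)\<^sup>2)" using mult_conj[of z] unfolding c .
    then have q: "z * z = of_real r * z - of_real ((norm z)\<^sup>2)" by (simp add: algebra_simps)
    have "(z - of_real (r/2)) * (z - of_real (r/2))
        = z * z - of_real r * z + of_real (r/2) * of_real (r/2)"
      by (simp add: field_simps)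
    also have "\<dots> = of_real ((r/2) * (r/2) - (norm z)\<^sup>2)" unfolding q by simp
    finally show ?thesis by blast
  qed
  have real_sq: "w \<in> \<real>" if "w * w = of_real b" "b \<ge> 0" for w :: 'k and b
  proof -
    have "(w - of_real (sqrt b)) * (w + of_real (sqrt b)) = w * w - of_real (sqrt b * sqrt b)"
      unfolding of_real_mult by (simp add: algebra_simps)
    with that have "(w - of_real (sqrt b)) * (w + of_real (sqrt b)) = 0" by simp
    then have "w = of_real (sqrt b) \<or> w = of_real (- sqrt b)"
      by (simp add: eq_neg_iff_add_eq_0)
    then show ?thesis using Reals_of_real by blast
  qed
  have form: "\<exists>a s w. z = of_real a + of_real s * w \<and> w * w = (-1::'k)" if "z \<notin> \<real>" for z
  proof -
    obtain a b where ab: "(z - of_real a) * (z - of_real a) = (of_real b :: 'k)" using root by blast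
    have b: "b < 0"
    proof (rule ccontr)
      assume "\<not> b < 0"
      then have "z - of_real a \<in> \<real>" using real_sq[OF ab] by simp
      then have "z - of_real a + of_real a \<in> \<real>" by (intro Reals_add) auto
      with that show False by simp
    qed
    define w where "w = (z - of_real a) / of_real (sqrt (-b))"
    have ss: "of_real (sqrt (-b)) * of_real (sqrt (-b)) = (- of_real b :: 'k)"
      using b by (simp flip: of_real_mult)
    have "w * w = (-1::'k)"
      using b unfolding w_def times_divide_times_eq ab ss by simp
    moreover have "z = of_real a + of_real (sqrt (-b)) * w" using b by (simp add: w_def)
    ultimately show ?thesis by blast
  qed
  obtain i :: 'k where i: "i * i = -1" using False form by blast
  have "\<exists>a b. z = of_real a + of_real b * i" for z
  proof (cases "z \<in> \<real>")
    case True
    then obtain a where "z = of_real a" by (auto elim: Reals_cases)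
    then have "z = of_real a + of_real 0 * i" by simp
    then show ?thesis by blast
  next
    case nr: False
    obtain a s w where w: "z = of_real a + of_real s * w" "w * w = -1" using form[OF nr] by blast
    have "(w - i) * (w + i) = 0" using w(2) i by (simp add: algebra_simps)
    then have "w = i \<or> w = - i" by (simp add: eq_neg_iff_add_eq_0)
    then have "z = of_real a + of_real s * i \<or> z = of_real a + of_real (- s) * i"
      using w(1) by auto
    then show ?thesis by blast
  qed
  with i show ?thesis by blast
qed simp

text \<open>
  A Hilbert space over \<open>'k\<close>: the norm of the Banach space \<open>'a\<close> comes from a \<open>'k\<close>-valued inner
  product, linear in the first argument.  The axiom \<open>smul_of_real\<close> ties the scalar multiplication
  to the real vector space structure that the type class provides.
\<close>

locale hilbert_space = vector_space smul
  for smul :: "'k::real_complex_field \<Rightarrow> 'a::banach \<Rightarrow> 'a" +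
  fixes ip :: "'a \<Rightarrow> 'a \<Rightarrow> 'k"
  assumes smul_of_real: "smul (of_real r) x = r *\<^sub>R x"
    and ip_add_left: "ip (x + y) z = ip x z + ip y z"
    and ip_smul_left: "ip (smul c x) y = c * ip x y"
    and ip_commute: "ip y x = conj (ip x y)"
    and ip_self: "ip x x = of_real ((norm x)\<^sup>2)"

lemma hilbert_space_real:
  "hilbert_space (scaleR :: real \<Rightarrow> 'a \<Rightarrow> 'a::{real_inner,banach}) inner"
  by unfold_locales
    (simp_all add: conj_real_def inner_add_left inner_add_right inner_commute scaleR_add_right scaleR_add_left
      power2_norm_eq_inner)

lemma hilbert_space_complex: "hilbert_space (*) (\<lambda>x y :: complex. x * cnj y)"
  by unfold_locales
    (simp_all add: conj_complex_def algebra_simps scaleR_conv_of_real flip: complex_norm_square)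

text \<open>
  The type of \<open>T\<close> already makes it bounded and real linear; it remains to require linearity over
  the scalar field, which is automatic for real scalars (\<open>bounded_ops_scaleR\<close>).
\<close>

definition bounded_ops :: "('k \<Rightarrow> 'a \<Rightarrow> 'a) \<Rightarrow> ('a::real_normed_vector \<Rightarrow>\<^sub>L 'a) set" where
  "bounded_ops smul = {T. \<forall>c x. blinfun_apply T (smul c x) = smul c (blinfun_apply T x)}"

lemma bounded_ops_scaleR: "bounded_ops scaleR = UNIV"
  by (simp add: bounded_ops_def blinfun.scaleR_right)

definition sot :: "('k \<Rightarrow> 'a \<Rightarrow> 'a) \<Rightarrow> ('a::real_normed_vector \<Rightarrow>\<^sub>L 'a) topology" where
  "sot smul = subtopology strong_operator_topology (bounded_ops smul)"

definition compact_operator :: "('a::real_normed_vector \<Rightarrow>\<^sub>L 'b::real_normed_vector) \<Rightarrow> bool" where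
  "compact_operator T \<longleftrightarrow> compact (closure (blinfun_apply T ` cball 0 1))"

end

theory Submission
  imports Defs
begin

text \<open>
  Since \<open>A\<close> is non-compact, it is bounded below by some \<open>c > 0\<close> on a unit vector of every subspace
  of finite codimension. Choosing such vectors \<open>e n\<close> inductively, with \<open>e n\<close> and \<open>A (e n)\<close>
  both orthogonal to their predecessors and \<open>A (e n)\<close> orthogonal to a prescribed finite set \<open>F\<close>,
  gives \<open>V\<close> and \<open>W\<close> with \<open>W A V = 1\<close>, \<open>W = 0\<close> on \<open>F\<close>, and the range of \<open>A V\<close> orthogonal to
  \<open>F\<close>. Given \<open>X0\<close>, \<open>Y0\<close> and the orthogonal projection \<open>P\<close> onto the span of finitely many
  vectors, take \<open>F\<close> to span the ranges of \<open>P\<close> and \<open>A Y0 P\<close>. With \<open>D = 1 - (1 - \<delta>) P\<close>, the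
  operators \<open>Y = Y0 P + V D\<close> and \<open>X = X0 P + (B - X0 P A Y0 P) D\<^sup>-\<^sup>1 W\<close> solve \<open>X A Y = B\<close>; on the
  range of \<open>P\<close>, \<open>X\<close> agrees with \<open>X0\<close> and \<open>Y\<close> with \<open>Y0 + \<delta> V\<close>.
\<close>

section \<open>The scalar field\<close>

lemma conj_0 [simp]: "conj (0::'k::real_complex_field) = 0"
  using conj_of_real[of 0, where 'k='k] by simp

lemma norm_conj [simp]: "norm (conj z) = norm (z::'k::real_complex_field)"
proof (cases "z = 0")
  case False
  have "norm z * norm (conj z) = norm z * norm z"
    using arg_cong[OF mult_conj[of z], of norm] by (simp add: norm_mult power2_eq_square)
  with False show ?thesis by simp
qed simp

text \<open>The class assumes only additivity and the value of \<open>z * conj z\<close>.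
  Multiplicativity follows because both sides, multiplied by \<open>z * w\<close>, give the squared
  norm of \<open>z * w\<close>, and a nonzero factor cancels.\<close>

lemma conj_mult [simp]: "conj (z * w) = conj z * conj (w::'k::real_complex_field)"
proof (cases "z * w = 0")
  case False
  have "(z * w) * conj (z * w) = (z * conj z) * (w * conj w)"
    unfolding mult_conj by (simp add: norm_mult power_mult_distrib)
  also have "\<dots> = (z * w) * (conj z * conj w)" by (simp add: algebra_simps)
  finally show ?thesis using False by (metis mult_cancel_left)
qed auto

lemma conj_conj [simp]: "conj (conj z) = (z::'k::real_complex_field)"
proof (cases "z = 0")
  case False
  have "conj z * conj (conj z) = conj z * z"
    using mult_conj[of "conj z"] mult_conj[of z] by (simp add: mult.commute)
  moreover have "conj z \<noteq> 0" using False by (metis norm_conj norm_eq_zero)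
  ultimately show ?thesis by simp
qed simp

text \<open>Over the reals the witness \<open>0\<close> suffices. Otherwise a root \<open>i\<close>
  of -1 has norm 1, so \<open>i * conj i = 1 = i * (- i)\<close> and \<open>conj i = - i\<close>;
  the squared norm of \<open>z\<close> is then \<open>a\<^sup>2 + b\<^sup>2\<close>, which bounds
  both coordinates.\<close>

lemma scalar_decomp:
  "\<exists>i::'k::real_complex_field. \<forall>z. \<exists>a b. z = of_real a + of_real b * i \<and> \<bar>a\<bar> \<le> norm z \<and> \<bar>b\<bar> \<le> norm z"
  using real_complex_cases[where 'k='k]
proof
  assume r: "\<forall>z::'k. z \<in> \<real>"
  show ?thesis
  proof (rule exI[of _ 0], rule allI)
    fix z :: 'k
    obtain a where "z = of_real a" using r by (auto elim: Reals_cases)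
    then show "\<exists>a b. z = of_real a + of_real b * 0 \<and> \<bar>a\<bar> \<le> norm z \<and> \<bar>b\<bar> \<le> norm z"
      by (intro exI[of _ a] exI[of _ 0]) simp
  qed
next
  assume "\<exists>i::'k. i * i = -1 \<and> (\<forall>z. \<exists>a b. z = of_real a + of_real b * i)"
  then obtain i :: 'k where i: "i * i = -1" and dec: "\<And>z. \<exists>a b. z = of_real a + of_real b * i"
    by blast
  have "norm i * norm i = 1" using i by (metis norm_minus_cancel norm_mult norm_one)
  then have "(norm i)\<^sup>2 = 1" by (simp add: power2_eq_square)
  then have "i * conj i = i * (- i)" using mult_conj[of i] i by simp
  then have ci: "conj i = - i" using i by (metis mult_cancel_left neg_equal_0_iff_equal mult_zero_left zero_neq_one)
  have *: "\<exists>a b. z = of_real a + of_real b * i \<and> \<bar>a\<bar> \<le> norm z \<and> \<bar>b\<bar> \<le> norm z" for z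
  proof -
    obtain a b where z: "z = of_real a + of_real b * i" using dec by blast
    have "z * conj z = (of_real a * of_real a) - (of_real b * of_real b) * (i * i)"
      unfolding z by (simp add: conj_add conj_of_real ci algebra_simps)
    then have "of_real ((norm z)\<^sup>2) = (of_real (a\<^sup>2 + b\<^sup>2) :: 'k)"
      unfolding mult_conj i by (simp add: power2_eq_square)
    then have e: "(norm z)\<^sup>2 = a\<^sup>2 + b\<^sup>2" by (simp only: of_real_eq_iff)
    then have "\<bar>a\<bar> \<le> norm z" "\<bar>b\<bar> \<le> norm z"
      using abs_le_square_iff[of a "norm z"] abs_le_square_iff[of b "norm z"] by simp_all
    with z show ?thesis by blast
  qed
  then show ?thesis by blast
qed

text \<open>By \<open>scalar_decomp\<close> the ball is a closed subset of a continuous image of a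
  product of two compact real intervals. This is where local compactness of the scalars enters the
  treatment of finite-rank operators.\<close>

lemma compact_cball_scalar: "compact (cball (0::'k::real_complex_field) r)"
proof -
  obtain i :: 'k where i: "\<And>z. \<exists>a b. z = of_real a + of_real b * i \<and> \<bar>a\<bar> \<le> norm z \<and> \<bar>b\<bar> \<le> norm z"
    using scalar_decomp[where 'k='k] by auto
  let ?f = "\<lambda>(a, b). of_real a + of_real b * i"
  have "compact (?f ` (cball 0 r \<times> cball 0 r))"
    by (intro compact_continuous_image compact_Times compact_cball)
      (auto simp: case_prod_beta intro!: continuous_intros)
  moreover have "cball (0::'k) r \<subseteq> ?f ` (cball 0 r \<times> cball 0 r)"
  proof
    fix z :: 'k assume "z \<in> cball 0 r"
    moreover obtain a b where "z = of_real a + of_real b * i" "\<bar>a\<bar> \<le> norm z" "\<bar>b\<bar> \<le> norm z"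
      using i by blast
    ultimately show "z \<in> ?f ` (cball 0 r \<times> cball 0 r)"
      by (intro image_eqI[of _ _ "(a, b)"]) auto
  qed
  ultimately show ?thesis
    by (metis closed_cball compact_Int_closed inf.absorb2)
qed

section \<open>Orthogonal sequences\<close>

context hilbert_space
begin

section \<open>Algebra of the inner product, Pythagoras and Cauchy--Schwarz\<close>

lemma ip_smul_right: "ip x (smul c y) = conj c * ip x y"
  by (subst ip_commute, subst ip_smul_left) (simp add: ip_commute[of x y])

lemma ip_add_right: "ip x (y + z) = ip x y + ip x z"
  by (subst ip_commute, subst ip_add_left) (simp add: conj_add ip_commute[of x y] ip_commute[of x z])

lemma ip_zero_left [simp]: "ip 0 y = 0"
  using ip_smul_left[of 0 0 y] by simp

lemma ip_zero_right [simp]: "ip y 0 = 0"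
  using ip_smul_right[of y 0 0] by simp

lemma ip_minus_left: "ip (- x) y = - ip x y"
  using ip_add_left[of x "- x" y] by (simp add: eq_neg_iff_add_eq_0 add.commute)

lemma ip_diff_left: "ip (x - z) y = ip x y - ip z y"
  using ip_add_left[of x "- z" y] by (simp add: ip_minus_left)

lemma ip_sum_left: "ip (sum f S) y = (\<Sum>i\<in>S. ip (f i) y)"
  by (induction S rule: infinite_finite_induct) (simp_all add: ip_add_left)

lemma ip_eq_0_commute: "ip x y = 0 \<longleftrightarrow> ip y x = 0"
  by (metis ip_commute conj_0)

lemma norm_smul [simp]: "norm (smul c x) = norm c * norm x"
proof -
  have "of_real ((norm (smul c x))\<^sup>2) = c * conj c * ip x x"
    by (simp only: ip_self[symmetric] ip_smul_left ip_smul_right mult.assoc mult.left_commute)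
  also have "\<dots> = of_real ((norm c * norm x)\<^sup>2)"
    by (simp add: mult_conj ip_self power_mult_distrib)
  finally have "(norm (smul c x))\<^sup>2 = (norm c * norm x)\<^sup>2" by (simp only: of_real_eq_iff)
  then show ?thesis by (rule power2_eq_imp_eq) auto
qed

lemma norm_pythagoras:
  assumes "ip x y = 0"
  shows "(norm (x + y))\<^sup>2 = (norm x)\<^sup>2 + (norm y)\<^sup>2"
proof -
  have "ip y x = 0" using assms by (simp add: ip_eq_0_commute)
  then have "ip (x + y) (x + y) = ip x x + ip y y" by (simp add: ip_add_left ip_add_right assms)
  then have "of_real ((norm (x + y))\<^sup>2) = (of_real ((norm x)\<^sup>2 + (norm y)\<^sup>2) :: 'k)"
    by (simp add: ip_self)
  then show ?thesis by (simp only: of_real_eq_iff)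
qed

text \<open>Cauchy--Schwarz: \<open>smul c y\<close> is the orthogonal projection of
  \<open>x\<close> onto the line through \<open>y\<close>, so Pythagoras bounds its norm by that of
  \<open>x\<close>.\<close>

lemma ip_bound: "norm (ip x y) \<le> norm x * norm y"
proof (cases "y = 0")
  case False
  define c where "c = ip x y * of_real (1 / (norm y)\<^sup>2)"
  have "ip (smul c y) (x - smul c y) = 0"
  proof -
    have "ip (x - smul c y) y = 0"
      using False by (simp add: ip_diff_left ip_smul_left c_def ip_self)
    then show ?thesis by (simp add: ip_smul_left ip_eq_0_commute)
  qed
  from norm_pythagoras[OF this] have "(norm (smul c y))\<^sup>2 \<le> (norm x)\<^sup>2" by simp
  then have "norm c * norm y \<le> norm x" using power2_le_imp_le by fastforce
  then show ?thesis using False by (simp add: c_def norm_mult norm_divide divide_simps power2_eq_square)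
qed simp

lemma bounded_linear_ip: "bounded_linear (\<lambda>x. ip x y)"
proof
  show "ip (r *\<^sub>R x) y = r *\<^sub>R ip x y" for r x
    using ip_smul_left[of "of_real r" x y] by (simp add: smul_of_real scaleR_conv_of_real)
  show "\<exists>K. \<forall>x. norm (ip x y) \<le> norm x * K" using ip_bound by blast
qed (rule ip_add_left)

lemma bounded_linear_smul: "bounded_linear (\<lambda>x. smul c x)"
proof
  show "smul c (r *\<^sub>R x) = r *\<^sub>R smul c x" for r x
    by (simp flip: smul_of_real add: mult.commute)
  show "\<exists>K. \<forall>x. norm (smul c x) \<le> norm x * K" by (intro exI[of _ "norm c"]) (simp add: mult.commute)
qed (rule scale_right_distrib)

lemma bounded_linear_smul_left: "bounded_linear (\<lambda>c. smul c x)"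
proof
  show "smul (r *\<^sub>R c) x = r *\<^sub>R smul c x" for r c
    by (simp add: scaleR_conv_of_real flip: smul_of_real)
  show "\<exists>K. \<forall>c. norm (smul c x) \<le> norm c * K" by (intro exI[of _ "norm x"]) simp
qed (rule scale_left_distrib)

section \<open>Orthogonal sequences, Bessel's identity and orthogonal series\<close>

definition orthogonal_seq :: "(nat \<Rightarrow> 'a) \<Rightarrow> bool" where
  "orthogonal_seq u \<longleftrightarrow> (\<forall>i j. i \<noteq> j \<longrightarrow> ip (u i) (u j) = 0)"

text \<open>Zero entries are admitted, so that Gram--Schmidt need not discard dependent vectors.\<close>

definition semi_orthonormal :: "(nat \<Rightarrow> 'a) \<Rightarrow> bool" where
  "semi_orthonormal u \<longleftrightarrow> orthogonal_seq u \<and> (\<forall>i. norm (u i) = 0 \<or> norm (u i) = 1)"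

lemma orthogonal_seqD: "orthogonal_seq u \<Longrightarrow> i \<noteq> j \<Longrightarrow> ip (u i) (u j) = 0"
  by (simp add: orthogonal_seq_def)

lemma semi_orthonormal_norm_le: "semi_orthonormal u \<Longrightarrow> norm (u i) \<le> 1"
  unfolding semi_orthonormal_def by (metis order.refl zero_le_one)

text \<open>Fits sequences built one vector at a time, where only orthogonality to the predecessors
  is at hand.\<close>

lemma orthogonal_seqI_less:
  assumes "\<And>i j. i < j \<Longrightarrow> ip (u j) (u i) = 0"
  shows "orthogonal_seq u"
  unfolding orthogonal_seq_def using assms ip_eq_0_commute nat_neq_iff by metis

lemma orthogonal_seq_smul: "orthogonal_seq u \<Longrightarrow> orthogonal_seq (\<lambda>n. smul (c n) (u n))"
  by (simp add: orthogonal_seq_def ip_smul_left ip_smul_right)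

lemma norm_orthogonal_sum:
  assumes "orthogonal_seq w" "finite S"
  shows "(norm (\<Sum>i\<in>S. smul (c i) (w i)))\<^sup>2 = (\<Sum>i\<in>S. (norm (c i))\<^sup>2 * (norm (w i))\<^sup>2)"
  using assms(2)
proof induction
  case (insert j S)
  have "ip (smul (c j) (w j)) (\<Sum>i\<in>S. smul (c i) (w i)) = 0"
  proof (subst ip_eq_0_commute, unfold ip_sum_left, intro sum.neutral ballI)
    fix i assume "i \<in> S"
    then have "i \<noteq> j" using insert.hyps by auto
    then show "ip (smul (c i) (w i)) (smul (c j) (w j)) = 0"
      by (simp add: ip_smul_left ip_smul_right orthogonal_seqD[OF assms(1)])
  qed
  from norm_pythagoras[OF this] insert show ?case by (simp add: power_mult_distrib)
qed simp

lemma semi_orthonormal_ip_self: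
  assumes "semi_orthonormal u"
  shows "ip (u i) (u i) * c = c \<or> u i = 0"
  using assms by (auto simp: semi_orthonormal_def ip_self)

lemma ip_semi_orthonormal_sum:
  assumes "semi_orthonormal u" "finite S"
  shows "ip (\<Sum>i\<in>S. smul (ip x (u i)) (u i)) (u j) = (if j \<in> S then ip x (u j) else 0)"
proof -
  have "ip (\<Sum>i\<in>S. smul (ip x (u i)) (u i)) (u j)
      = (\<Sum>i\<in>S. if i = j then ip x (u j) * ip (u j) (u j) else 0)"
    unfolding ip_sum_left ip_smul_left
    using assms(1) by (intro sum.cong) (auto simp: semi_orthonormal_def orthogonal_seq_def)
  also have "\<dots> = (if j \<in> S then ip x (u j) * ip (u j) (u j) else 0)"
    using assms(2) by simp
  finally show ?thesis
    \<comment> \<open>A zero entry does no harm: if \<open>u j = 0\<close>, both sides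
      vanish.\<close>
    using semi_orthonormal_ip_self[OF assms(1), of j "ip x (u j)"]
    by (auto simp: mult.commute)
qed

text \<open>Kept as an equation because both summands get used: the coefficients are
  square-summable, and subtracting the projection does not increase the norm.\<close>

lemma bessel:
  assumes "semi_orthonormal u" "finite S"
  shows "(norm x)\<^sup>2 = (norm (x - (\<Sum>i\<in>S. smul (ip x (u i)) (u i))))\<^sup>2 + (\<Sum>i\<in>S. (norm (ip x (u i)))\<^sup>2)"
proof -
  let ?p = "\<Sum>i\<in>S. smul (ip x (u i)) (u i)"
  have o: "ip (u j) (x - ?p) = 0" if "j \<in> S" for j
    using that assms by (subst ip_eq_0_commute) (simp add: ip_diff_left ip_semi_orthonormal_sum)
  have "ip ?p (x - ?p) = 0"
    unfolding ip_sum_left ip_smul_left using o by (intro sum.neutral) auto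
  from norm_pythagoras[OF this] have "(norm x)\<^sup>2 = (norm ?p)\<^sup>2 + (norm (x - ?p))\<^sup>2" by simp
  also have "(norm ?p)\<^sup>2 = (\<Sum>i\<in>S. (norm (ip x (u i)))\<^sup>2 * (norm (u i))\<^sup>2)"
    using assms by (intro norm_orthogonal_sum) (auto simp: semi_orthonormal_def)
  also have "\<dots> = (\<Sum>i\<in>S. (norm (ip x (u i)))\<^sup>2)"
  proof (intro sum.cong refl)
    fix i
    have "norm (u i) = 0 \<or> norm (u i) = 1" using assms(1) unfolding semi_orthonormal_def by blast
    then show "(norm (ip x (u i)))\<^sup>2 * (norm (u i))\<^sup>2 = (norm (ip x (u i)))\<^sup>2" by auto
  qed
  finally show ?thesis by simp
qed

text \<open>By Pythagoras, the squared norm of any block of the series is at most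
  \<open>K\<^sup>2\<close> times the same block of the squared coefficients, so the Cauchy criterion
  carries over; the norm bound passes to the limit from the partial sums.\<close>

lemma summable_orthogonal_series:
  assumes w: "orthogonal_seq w" "\<And>n. norm (w n) \<le> K"
    and c: "\<And>N. (\<Sum>i<N. (norm (c i))\<^sup>2) \<le> M"
  shows "summable (\<lambda>i. smul (c i) (w i))"
    and "norm (\<Sum>i. smul (c i) (w i)) \<le> K * sqrt M"
proof -
  have K: "0 \<le> K" using w(2)[of 0] norm_ge_zero[of "w 0"] by linarith
  have bound: "(norm (\<Sum>i\<in>S. smul (c i) (w i)))\<^sup>2 \<le> K\<^sup>2 * (\<Sum>i\<in>S. (norm (c i))\<^sup>2)" if "finite S" for S
  proof -
    have "(\<Sum>i\<in>S. (norm (c i))\<^sup>2 * (norm (w i))\<^sup>2) \<le> (\<Sum>i\<in>S. (norm (c i))\<^sup>2 * K\<^sup>2)"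
      using w(2) by (intro sum_mono mult_left_mono power_mono) auto
    then show ?thesis
      by (simp add: norm_orthogonal_sum[OF w(1) that] sum_distrib_left mult.commute)
  qed
  have "summable (\<lambda>i. (norm (c i))\<^sup>2)"
    using c[of "Suc n" for n] by (intro bounded_imp_summable[where B=M]) (simp_all only: lessThan_Suc_atMost zero_le_power2)
  then have cau: "\<exists>N. \<forall>m\<ge>N. \<forall>n. norm (\<Sum>i=m..<n. (norm (c i))\<^sup>2) < e" if "e > 0" for e
    using that unfolding summable_Cauchy by blast
  show s: "summable (\<lambda>i. smul (c i) (w i))"
    unfolding summable_Cauchy
  proof (intro allI impI)
    fix e :: real assume e: "0 < e"
    \<comment> \<open>The summand 1 avoids a division by zero when \<open>K = 0\<close>.\<close>
    then have "0 < e\<^sup>2 / (K\<^sup>2 + 1)" by (simp add: add_nonneg_pos)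
    from cau[OF this] obtain N
      where N: "\<And>m n. m \<ge> N \<Longrightarrow> norm (\<Sum>i=m..<n. (norm (c i))\<^sup>2) < e\<^sup>2 / (K\<^sup>2 + 1)" by blast
    show "\<exists>N. \<forall>m\<ge>N. \<forall>n. norm (\<Sum>i=m..<n. smul (c i) (w i)) < e"
    proof (intro exI allI impI)
      fix m n assume "N \<le> m"
      let ?s = "\<Sum>i=m..<n. (norm (c i))\<^sup>2"
      have s0: "0 \<le> ?s" by (intro sum_nonneg) auto
      with N[OF \<open>N \<le> m\<close>, of n] have "?s < e\<^sup>2 / (K\<^sup>2 + 1)" by simp
      then have "?s * (K\<^sup>2 + 1) < e\<^sup>2"
        by (subst (asm) pos_less_divide_eq) (auto simp: add_nonneg_pos)
      moreover have "K\<^sup>2 * ?s \<le> ?s * (K\<^sup>2 + 1)" using s0 by (simp add: algebra_simps)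
      ultimately have "(norm (\<Sum>i=m..<n. smul (c i) (w i)))\<^sup>2 < e\<^sup>2"
        using bound[of "{m..<n}"] by simp
      then show "norm (\<Sum>i=m..<n. smul (c i) (w i)) < e"
        by (rule power2_less_imp_less) (use e in simp)
    qed
  qed
  have M: "0 \<le> M" using c[of 0] by simp
  show "norm (\<Sum>i. smul (c i) (w i)) \<le> K * sqrt M"
  proof (rule LIMSEQ_le_const2)
    show "(\<lambda>N. norm (\<Sum>i<N. smul (c i) (w i))) \<longlonglongrightarrow> norm (\<Sum>i. smul (c i) (w i))"
      by (intro tendsto_norm summable_LIMSEQ s)
    have "norm (\<Sum>i<N. smul (c i) (w i)) \<le> K * sqrt M" for N
    proof (rule power2_le_imp_le)
      have "K\<^sup>2 * (\<Sum>i<N. (norm (c i))\<^sup>2) \<le> K\<^sup>2 * M"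
        by (intro mult_left_mono c) auto
      then show "(norm (\<Sum>i<N. smul (c i) (w i)))\<^sup>2 \<le> (K * sqrt M)\<^sup>2"
        using bound[of "{..<N}"] M by (simp add: power_mult_distrib)
    qed (use K M in simp)
    then show "\<exists>N. \<forall>n\<ge>N. norm (\<Sum>i<n. smul (c i) (w i)) \<le> K * sqrt M" by blast
  qed
qed

text \<open>The source of every projection and factor built below. Bessel bounds the squared
  coefficients by \<open>(norm x)\<^sup>2\<close>, so the series converges and \<open>K\<close>
  bounds the operator.\<close>

lemma series_operator:
  assumes u: "semi_orthonormal u" and w: "orthogonal_seq w" "\<And>n. norm (w n) \<le> K"
  obtains T where "T \<in> bounded_ops smul" "\<And>x. (\<lambda>n. smul (ip x (u n)) (w n)) sums blinfun_apply T x"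
proof -
  let ?t = "\<lambda>x n. smul (ip x (u n)) (w n)"
  have c: "(\<Sum>i<N. (norm (ip x (u i)))\<^sup>2) \<le> (norm x)\<^sup>2" for x N
    using bessel[OF u, of "{..<N}" x] by simp
  note s = summable_orthogonal_series[OF w c]
  have lin: "bounded_linear (\<lambda>x. suminf (?t x))"
  proof
    show "suminf (?t (x + y)) = suminf (?t x) + suminf (?t y)" for x y
      by (subst suminf_add[OF s(1) s(1)]) (simp add: ip_add_left scale_left_distrib)
    show "suminf (?t (r *\<^sub>R x)) = r *\<^sub>R suminf (?t x)" for r x
    proof -
      have "?t (r *\<^sub>R x) = (\<lambda>n. r *\<^sub>R ?t x n)"
        by (simp flip: smul_of_real add: ip_smul_left)
      then show ?thesis by (simp add: suminf_scaleR_right[OF s(1)])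
    qed
    have "norm (suminf (?t x)) \<le> norm x * K" for x using s(2)[of x] by (simp add: mult.commute)
    then show "\<exists>K. \<forall>x. norm (suminf (?t x)) \<le> norm x * K" by blast
  qed
  show ?thesis
  proof (rule that)
    show "Blinfun (\<lambda>x. suminf (?t x)) \<in> bounded_ops smul"
    proof -
      have "suminf (?t (smul c x)) = smul c (suminf (?t x))" for c x
        by (subst bounded_linear.suminf[OF bounded_linear_smul s(1)]) (simp add: ip_smul_left)
      then show ?thesis by (simp add: bounded_ops_def bounded_linear_Blinfun_apply[OF lin])
    qed
    show "?t x sums blinfun_apply (Blinfun (\<lambda>x. suminf (?t x))) x" for x
      unfolding bounded_linear_Blinfun_apply[OF lin] by (rule summable_sums[OF s(1)])
  qed
qed

section \<open>Gram--Schmidt\<close>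

lemma gram_schmidt:
  obtains g where "semi_orthonormal g" "\<And>n. d n = (\<Sum>i<Suc n. smul (ip (d n) (g i)) (g i))"
proof -
  let ?r = "\<lambda>g n. d n - (\<Sum>i<n. smul (ip (d n) (g i)) (g i))"
  let ?f = "\<lambda>g n. smul (of_real (1 / norm (?r g n))) (?r g n)"
  \<comment> \<open>Well-founded recursion, since each vector depends on all earlier ones. A zero
    residual yields \<open>g n = 0\<close>, because \<open>1 / 0 = 0\<close>.\<close>
  define g where "g = wfrec less_than ?f"
  have g: "g n = ?f g n" for n
  proof -
    have "g n = ?f (cut g less_than n) n"
      unfolding g_def by (subst wfrec) auto
    also have "(\<Sum>i<n. smul (ip (d n) (cut g less_than n i)) (cut g less_than n i))
       = (\<Sum>i<n. smul (ip (d n) (g i)) (g i))" by (intro sum.cong) (auto simp: cut_apply)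
    finally show ?thesis .
  qed
  have nrm: "norm (g n) = 0 \<or> norm (g n) = 1" for n
    by (subst (1 2) g) (auto simp: norm_divide)
  have orth: "i < j \<Longrightarrow> ip (g j) (g i) = 0" for i j
  proof (induction j arbitrary: i rule: less_induct)
    case (less j)
    \<comment> \<open>Orthogonality is known only below \<open>j\<close>. Extending by zero gives a
      full semi-orthonormal sequence, to which the projection formula applies.\<close>
    define h where "h = (\<lambda>i. if i < j then g i else 0)"
    have "orthogonal_seq h"
      by (rule orthogonal_seqI_less) (auto simp: h_def less.IH)
    then have h: "semi_orthonormal h" using nrm by (simp add: semi_orthonormal_def h_def)
    have "(\<Sum>i<j. smul (ip (d j) (g i)) (g i)) = (\<Sum>i<j. smul (ip (d j) (h i)) (h i))"
      by (intro sum.cong) (auto simp: h_def)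
    then have "ip (?r g j) (h i) = 0"
      using \<open>i < j\<close> by (simp add: ip_diff_left ip_semi_orthonormal_sum[OF h])
    then have "ip (?r g j) (g i) = 0" using \<open>i < j\<close> by (simp add: h_def)
    then show ?case by (subst g) (simp add: ip_smul_left)
  qed
  then have o: "orthogonal_seq g" by (rule orthogonal_seqI_less)
  have "d n = (\<Sum>i<Suc n. smul (ip (d n) (g i)) (g i))" for n
  proof -
    let ?c = "of_real (norm (?r g n)) :: 'k"
    have r: "?r g n = smul ?c (g n)" by (subst (2) g) simp
    \<comment> \<open>The coefficient of \<open>d n\<close> along \<open>g n\<close> comes from the
      residual alone, so the new term of the sum restores exactly that residual.\<close>
    have "ip (d n) (g n) = ip (?r g n + (\<Sum>i<n. smul (ip (d n) (g i)) (g i))) (g n)" by simp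
    also have "\<dots> = ip (?r g n) (g n)"
      unfolding ip_add_left ip_sum_left ip_smul_left
      using orth ip_eq_0_commute by (simp add: orthogonal_seqD[OF o])
    also have "\<dots> = ?c * ip (g n) (g n)" by (subst (1) r) (simp add: ip_smul_left)
    finally have "smul (ip (d n) (g n)) (g n) = smul ?c (g n)"
      using nrm[of n] by (auto simp: ip_self)
    then have "smul (ip (d n) (g n)) (g n) = ?r g n" using r[symmetric] by (rule trans)
    then show ?thesis by simp
  qed
  then show ?thesis using that o nrm by (auto simp: semi_orthonormal_def)
qed

text \<open>Gram--Schmidt is applied to a dense sequence \<open>d\<close>. Partial sums from
  \<open>Suc n\<close> on reproduce \<open>d n\<close>, so the error at \<open>x\<close> equals the
  error at \<open>x - d n\<close>, which Bessel bounds by \<open>norm (x - d n)\<close>.\<close>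

lemma semi_orthonormal_basis_exists:
  assumes "separable_space (euclidean :: 'a topology)"
  obtains b where "semi_orthonormal b" "\<And>x. (\<lambda>n. smul (ip x (b n)) (b n)) sums x"
proof -
  obtain C :: "'a set" where C: "countable C" "closure C = UNIV"
    using assms by (auto simp: separable_space_def)
  then have "C \<noteq> {}" by auto
  define d where "d = from_nat_into C"
  obtain b where b: "semi_orthonormal b" and db: "\<And>n. d n = (\<Sum>i<Suc n. smul (ip (d n) (b i)) (b i))"
    using gram_schmidt by blast
  have "(\<lambda>n. smul (ip x (b n)) (b n)) sums x" for x
    unfolding sums_def
  proof (rule LIMSEQ_I)
    fix e :: real assume "0 < e"
    let ?s = "\<lambda>x N. \<Sum>i<N. smul (ip x (b i)) (b i)"
    obtain y where "y \<in> C" "dist y x < e"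
      using \<open>0 < e\<close> C(2) closure_approachable by blast
    then obtain n where n: "dist (d n) x < e"
      unfolding d_def using from_nat_into_surj[OF C(1)] by metis
    show "\<exists>N. \<forall>m\<ge>N. norm (?s x m - x) < e"
    proof (intro exI allI impI)
      fix m assume m: "Suc n \<le> m"
      have "ip (d n) (b i) = 0" if "i \<ge> Suc n" for i
      proof -
        have "ip (d n) (b i) = ip (\<Sum>i<Suc n. smul (ip (d n) (b i)) (b i)) (b i)"
          by (subst (1) db) (rule refl)
        then show ?thesis using that ip_semi_orthonormal_sum[OF b, of "{..<Suc n}" "d n" i] by simp
      qed
      then have "?s (d n) m = ?s (d n) (Suc n)"
        using m by (intro sum.mono_neutral_right) auto
      then have "d n - ?s (d n) m = 0" using db[of n] by simp
      then have "x - ?s x m = (x - d n) - ?s (x - d n) m"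
        by (simp add: ip_diff_left scale_left_diff_distrib sum_subtractf)
      moreover have "norm ((x - d n) - ?s (x - d n) m) \<le> norm (x - d n)"
      proof (rule power2_le_imp_le)
        have "0 \<le> (\<Sum>i<m. (norm (ip (x - d n) (b i)))\<^sup>2)" by (intro sum_nonneg) auto
        then show "(norm ((x - d n) - ?s (x - d n) m))\<^sup>2 \<le> (norm (x - d n))\<^sup>2"
          using bessel[OF b, of "{..<m}" "x - d n"] by simp
      qed simp
      ultimately have "norm (x - ?s x m) \<le> norm (x - d n)" by (simp only:)
      also have "\<dots> < e" using n by (simp add: dist_norm norm_minus_commute)
      finally show "norm (?s x m - x) < e" by (simp only: norm_minus_commute)
    qed
  qed
  with b show ?thesis using that by blast
qed

lemma finite_projection:
  assumes "finite S"
  obtains P and g :: "nat \<Rightarrow> 'a" and N :: nat where "P \<in> bounded_ops smul" "semi_orthonormal g"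
    "\<And>x. blinfun_apply P x = (\<Sum>i<N. smul (ip x (g i)) (g i))"
    "\<And>s. s \<in> S \<Longrightarrow> blinfun_apply P s = s"
proof -
  obtain N :: nat and d where S: "S = d ` {i. i < N}"
    using finite_imp_nat_seg_image_inj_on[OF assms] by blast
  obtain g where g: "semi_orthonormal g" and dg: "\<And>n. d n = (\<Sum>i<Suc n. smul (ip (d n) (g i)) (g i))"
    using gram_schmidt by blast
  \<comment> \<open>Only the first \<open>N\<close> vectors come from \<open>S\<close>. Cutting off
    at \<open>N\<close> turns the operator series into a finite sum.\<close>
  define h where "h = (\<lambda>i. if i < N then g i else 0)"
  have h: "semi_orthonormal h" using g by (auto simp: semi_orthonormal_def orthogonal_seq_def h_def)
  then have oh: "orthogonal_seq h" by (simp add: semi_orthonormal_def)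
  obtain P where P: "P \<in> bounded_ops smul" "\<And>x. (\<lambda>n. smul (ip x (h n)) (h n)) sums blinfun_apply P x"
    using series_operator[OF h oh semi_orthonormal_norm_le[OF h]] by blast
  have Px: "blinfun_apply P x = (\<Sum>i<N. smul (ip x (g i)) (g i))" for x
  proof -
    have "(\<lambda>n. smul (ip x (h n)) (h n)) sums (\<Sum>i<N. smul (ip x (h i)) (h i))"
      by (rule sums_finite) (auto simp: h_def)
    then have "blinfun_apply P x = (\<Sum>i<N. smul (ip x (h i)) (h i))"
      using P(2) sums_unique2 by blast
    also have "\<dots> = (\<Sum>i<N. smul (ip x (g i)) (g i))" by (intro sum.cong) (auto simp: h_def)
    finally show ?thesis .
  qed
  show ?thesis
  proof (rule that[OF P(1) g Px])
    fix s assume "s \<in> S"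
    then obtain n where n: "n < N" "s = d n" using S by auto
    have "ip (d n) (g i) = 0" if "i \<ge> Suc n" for i
    proof -
      have "ip (d n) (g i) = ip (\<Sum>i<Suc n. smul (ip (d n) (g i)) (g i)) (g i)"
        by (subst (1) dg) (rule refl)
      then show ?thesis using that ip_semi_orthonormal_sum[OF g, of "{..<Suc n}" "d n" i] by simp
    qed
    then have "blinfun_apply P (d n) = (\<Sum>i<Suc n. smul (ip (d n) (g i)) (g i))"
      unfolding Px using n by (intro sum.mono_neutral_right) auto
    then show "blinfun_apply P s = s" using n dg by simp
  qed
qed

section \<open>Non-compact operators factor the identity\<close>

lemma bounded_opsD: "T \<in> bounded_ops smul \<Longrightarrow> blinfun_apply T (smul c x) = smul c (blinfun_apply T x)"
  by (simp add: bounded_ops_def)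

lemma bounded_linear_ip_right: "bounded_linear (\<lambda>y. ip x y)"
proof
  show "ip x (r *\<^sub>R y) = r *\<^sub>R ip x y" for r y
    using ip_smul_right[of x "of_real r" y] by (simp add: smul_of_real scaleR_conv_of_real conj_of_real)
  show "\<exists>K. \<forall>y. norm (ip x y) \<le> norm y * K"
    using ip_bound[of x] by (metis mult.commute)
qed (rule ip_add_right)

text \<open>The vector \<open>z\<close> is the value of the adjoint of \<open>A\<close> at
  \<open>y\<close>, built from its coefficients in the basis. Pointwise existence is enough for the
  later construction.\<close>

lemma adjoint_vector:
  assumes b: "semi_orthonormal b" "\<And>x. (\<lambda>n. smul (ip x (b n)) (b n)) sums x"
    and A: "A \<in> bounded_ops smul"
  shows "\<exists>z. \<forall>x. ip (blinfun_apply A x) y = ip x z"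
proof -
  define c where "c i = ip y (blinfun_apply A (b i))" for i
  define L where "L = norm y * norm A"
  have ob: "orthogonal_seq b" using b(1) by (simp add: semi_orthonormal_def)
  have le: "(\<Sum>i<N. (norm (c i))\<^sup>2) \<le> L\<^sup>2" for N
  proof -
    let ?s = "\<Sum>i<N. (norm (c i))\<^sup>2"
    define v where "v = (\<Sum>i<N. smul (c i) (b i))"
    have s0: "0 \<le> ?s" by (intro sum_nonneg) auto
    \<comment> \<open>Testing \<open>A\<close> on the partial sum \<open>v\<close> turns the pairing
      into the sum \<open>?s\<close> of squared coefficients itself. Then \<open>?s\<close> is at
      most \<open>L * norm v\<close>, while \<open>(norm v)\<^sup>2\<close> is at most
      \<open>?s\<close>, which forces \<open>?s\<close> below \<open>L\<^sup>2\<close>.\<close>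
    have "ip y (blinfun_apply A v) = (\<Sum>i<N. of_real ((norm (c i))\<^sup>2))"
      unfolding v_def blinfun.sum_right bounded_linear.linear[OF bounded_linear_ip_right, THEN linear_sum]
        bounded_opsD[OF A] ip_smul_right
      by (intro sum.cong refl) (simp add: mult_conj mult.commute flip: c_def)
    also have "\<dots> = of_real ?s" by simp
    finally have "?s = norm (ip y (blinfun_apply A v))" using s0 by (simp only: norm_of_real abs_of_nonneg)
    also have "\<dots> \<le> norm y * norm (blinfun_apply A v)" by (rule ip_bound)
    also have "\<dots> \<le> norm y * (norm A * norm v)" by (intro mult_left_mono norm_blinfun) simp
    finally have sL: "?s \<le> L * norm v" by (simp add: L_def mult.assoc)
    have "(norm v)\<^sup>2 \<le> ?s"
      unfolding v_def norm_orthogonal_sum[OF ob finite_lessThan]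
    proof (intro sum_mono)
      fix i
      have "(norm (b i))\<^sup>2 \<le> 1" using semi_orthonormal_norm_le[OF b(1), of i] by (simp add: power_le_one)
      then show "(norm (c i))\<^sup>2 * (norm (b i))\<^sup>2 \<le> (norm (c i))\<^sup>2"
        by (intro mult_left_le) auto
    qed
    then have "L\<^sup>2 * (norm v)\<^sup>2 \<le> L\<^sup>2 * ?s" by (intro mult_left_mono) auto
    moreover have "?s\<^sup>2 \<le> (L * norm v)\<^sup>2" using sL s0 by (intro power_mono)
    ultimately have "?s * ?s \<le> L\<^sup>2 * ?s" by (simp add: power_mult_distrib power2_eq_square[of ?s])
    then show ?thesis using s0 by (cases "?s = 0") auto
  qed
  define z where "z = (\<Sum>i. smul (c i) (b i))"
  have z: "(\<lambda>i. smul (c i) (b i)) sums z"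
    unfolding z_def
    by (intro summable_sums summable_orthogonal_series(1)[OF ob semi_orthonormal_norm_le[OF b(1)] le])
  have "ip (blinfun_apply A x) y = ip x z" for x
  proof -
    have "(\<lambda>i. ip (blinfun_apply A (smul (ip x (b i)) (b i))) y) sums ip (blinfun_apply A x) y"
      by (intro bounded_linear.sums[OF bounded_linear_ip] bounded_linear.sums[OF blinfun.bounded_linear_right] b(2))
    moreover have "(\<lambda>i. ip x (smul (c i) (b i))) sums ip x z"
      by (intro bounded_linear.sums[OF bounded_linear_ip_right] z)
    moreover have "ip (blinfun_apply A (smul (ip x (b i)) (b i))) y = ip x (smul (c i) (b i))" for i
      unfolding bounded_opsD[OF A] ip_smul_left ip_smul_right c_def
      by (subst ip_commute[of y "blinfun_apply A (b i)"]) (simp add: mult.commute)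
    ultimately show ?thesis using sums_unique2 by auto
  qed
  then show ?thesis by blast
qed

text \<open>Each further vector adds, as a Minkowski sum, the compact image of the unit ball of
  scalars.\<close>

lemma compact_combinations:
  "\<exists>C. compact C \<and> (\<forall>f. (\<forall>i. norm (f i) \<le> 1) \<longrightarrow> (\<Sum>i<N::nat. smul (f i) (h i)) \<in> C)"
proof (induction N)
  case 0
  show ?case by (intro exI[of _ "{0}"]) auto
next
  case (Suc N)
  then obtain C where C: "compact C" "\<And>f. (\<forall>i. norm (f i) \<le> 1) \<Longrightarrow> (\<Sum>i<N. smul (f i) (h i)) \<in> C"
    by blast
  let ?D = "(\<lambda>c. smul c (h N)) ` cball 0 1"
  have "compact ?D"
    by (intro compact_continuous_image compact_cball_scalar linear_continuous_on bounded_linear_smul_left)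
  then have "compact {x + y | x y. x \<in> C \<and> y \<in> ?D}" by (rule compact_sums[OF C(1)])
  then show ?case
  proof (intro exI conjI allI impI)
    fix f :: "nat \<Rightarrow> 'k" assume f: "\<forall>i. norm (f i) \<le> 1"
    then have "smul (f N) (h N) \<in> ?D" by auto
    with C(2)[OF f] show "(\<Sum>i<Suc N. smul (f i) (h i)) \<in> {x + y | x y. x \<in> C \<and> y \<in> ?D}" by auto
  qed
qed

text \<open>Contrapositive: if no such \<open>c\<close> exists, then for every tolerance
  \<open>A\<close> is small on the orthogonal complement of some finite set. Hence \<open>A\<close>
  is uniformly close on the unit ball to an operator \<open>A P\<close> of finite rank, and the
  image of the ball is totally bounded.\<close>

lemma noncompact_lower_bound:
  assumes A: "A \<in> bounded_ops smul" and nc: "\<not> compact_operator A"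
  obtains c where "c > 0"
    "\<And>S. finite S \<Longrightarrow> \<exists>e. norm e = 1 \<and> (\<forall>s\<in>S. ip e s = 0) \<and> c \<le> norm (blinfun_apply A e)"
proof (rule ccontr)
  note no_bound = that
  assume "\<not> thesis"
  then have neg: "\<exists>S. finite S \<and> (\<forall>e. norm e = 1 \<longrightarrow> (\<forall>s\<in>S. ip e s = 0) \<longrightarrow> norm (blinfun_apply A e) < c)"
    if "c > 0" for c
    using that no_bound
    by (meson not_le)
  let ?T = "blinfun_apply A ` cball 0 1"
  have "\<exists>k. finite k \<and> closure ?T \<subseteq> (\<Union>x\<in>k. ball x \<epsilon>)" if e: "\<epsilon> > 0" for \<epsilon>
  proof -
    obtain S where S: "finite S"
      "\<And>e. norm e = 1 \<Longrightarrow> (\<And>s. s \<in> S \<Longrightarrow> ip e s = 0) \<Longrightarrow> norm (blinfun_apply A e) < \<epsilon> / 3"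
      using neg[of "\<epsilon> / 3"] e by auto
    obtain P g and N :: nat where P: "P \<in> bounded_ops smul" and g: "semi_orthonormal g"
      and Px: "\<And>x. blinfun_apply P x = (\<Sum>i<N. smul (ip x (g i)) (g i))"
      and PS: "\<And>s. s \<in> S \<Longrightarrow> blinfun_apply P s = s"
      by (rule finite_projection[OF S(1)]) (rule that)
    obtain C where C: "compact C"
      "\<And>f. (\<forall>i. norm (f i) \<le> 1) \<Longrightarrow> (\<Sum>i<N. smul (f i) (blinfun_apply A (g i))) \<in> C"
      using compact_combinations[where N = N and h = "\<lambda>i. blinfun_apply A (g i)"] by blast
    obtain k where k: "finite k" "C \<subseteq> (\<Union>x\<in>k. ball x (\<epsilon> / 3))"
      using C(1) e unfolding compact_eq_totally_bounded by (meson zero_less_divide_iff zero_less_numeral)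
    \<comment> \<open>One third of \<epsilon> is spent on the net for \<open>C\<close> and one third
      on \<open>A (x - P x)\<close>. Closed balls of radius \<open>2 * \<epsilon> / 3\<close> also
      cover the closure and still lie in the open balls of radius \<epsilon>.\<close>
    have "?T \<subseteq> (\<Union>x\<in>k. cball x (2 * \<epsilon> / 3))"
    proof
      fix y assume "y \<in> ?T"
      then obtain x where x: "y = blinfun_apply A x" "norm x \<le> 1" by auto
      have "norm (ip x (g i)) \<le> 1" for i
      proof -
        have "norm (ip x (g i)) \<le> norm x * norm (g i)" by (rule ip_bound)
        also have "\<dots> \<le> 1 * 1" using x(2) semi_orthonormal_norm_le[OF g] by (intro mult_mono) auto
        finally show ?thesis by simp
      qed
      then have "blinfun_apply A (blinfun_apply P x) \<in> C"
        unfolding Px blinfun.sum_right bounded_opsD[OF A] by (intro C(2)) auto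
      then obtain q where q: "q \<in> k" "dist q (blinfun_apply A (blinfun_apply P x)) < \<epsilon> / 3"
        using k(2) by auto
      define u where "u = x - blinfun_apply P x"
      have "(norm u)\<^sup>2 \<le> (norm x)\<^sup>2"
        using bessel[OF g, of "{..<N}" x] by (simp add: u_def Px sum_nonneg)
      then have u1: "norm u \<le> 1" using x(2) power2_le_imp_le[of "norm u" "norm x"] by simp
      have ug: "ip u (g i) = 0" if "i < N" for i
        using that by (simp add: u_def Px ip_diff_left ip_semi_orthonormal_sum[OF g])
      have us: "ip u s = 0" if "s \<in> S" for s
      proof -
        have "ip s u = ip (\<Sum>i<N. smul (ip s (g i)) (g i)) u"
          using PS[OF that] by (simp add: Px)
        also have "\<dots> = 0"
          unfolding ip_sum_left ip_smul_left using ug by (intro sum.neutral) (auto simp: ip_eq_0_commute)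
        finally show ?thesis by (simp add: ip_eq_0_commute)
      qed
      have "norm (blinfun_apply A u) \<le> \<epsilon> / 3"
      proof (cases "u = 0")
        case False
        \<comment> \<open>The smallness of \<open>A\<close> is known for unit vectors only, so
          \<open>u\<close> is normalised and the estimate scaled back.\<close>
        define e where "e = smul (of_real (1 / norm u)) u"
        have "norm e = 1" using False by (simp add: e_def norm_divide)
        moreover have "ip e s = 0" if "s \<in> S" for s using us[OF that] by (simp add: e_def ip_smul_left)
        ultimately have "norm (blinfun_apply A e) < \<epsilon> / 3" by (rule S(2))
        then have "norm (blinfun_apply A u) < \<epsilon> / 3 * norm u"
          using False by (simp add: e_def bounded_opsD[OF A] norm_divide field_simps)
        also have "\<dots> \<le> \<epsilon> / 3 * 1" using u1 e by (intro mult_left_mono) auto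
        finally show ?thesis by simp
      qed (use e in simp)
      then have "dist (blinfun_apply A (blinfun_apply P x)) y \<le> \<epsilon> / 3"
        by (simp add: u_def x(1) dist_norm blinfun.diff_right norm_minus_commute)
      then have "dist q y \<le> 2 * \<epsilon> / 3"
        using q(2) dist_triangle[of q y "blinfun_apply A (blinfun_apply P x)"] by simp
      then show "y \<in> (\<Union>x\<in>k. cball x (2 * \<epsilon> / 3))" using q(1) by auto
    qed
    then have "closure ?T \<subseteq> (\<Union>x\<in>k. cball x (2 * \<epsilon> / 3))"
      using k(1) by (intro closure_minimal closed_UN) auto
    also have "\<dots> \<subseteq> (\<Union>x\<in>k. ball x \<epsilon>)" using e by fastforce
    finally show ?thesis using k(1) by blast
  qed
  then have "compact (closure ?T)"
    unfolding compact_eq_totally_bounded by (simp add: complete_eq_closed)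
  with nc show False by (simp add: compact_operator_def)
qed

text \<open>\<open>V\<close> replaces the basis vectors \<open>b n\<close> by unit vectors
  \<open>e n\<close> with orthogonal images \<open>a n\<close> under \<open>A\<close>;
  \<open>W\<close> reads off the coefficients along the \<open>a n\<close> and puts them back on the
  \<open>b n\<close>. The lower bound on \<open>norm (a n)\<close> keeps \<open>W\<close>
  bounded.\<close>

lemma noncompact_factors_identity:
  assumes b: "semi_orthonormal b" "\<And>x. (\<lambda>n. smul (ip x (b n)) (b n)) sums x"
    and A: "A \<in> bounded_ops smul" "\<not> compact_operator A" and F: "finite F"
  obtains V W where "V \<in> bounded_ops smul" "W \<in> bounded_ops smul"
    "\<And>x. blinfun_apply W (blinfun_apply A (blinfun_apply V x)) = x"
    "\<And>h. h \<in> F \<Longrightarrow> blinfun_apply W h = 0"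
    "\<And>h x. h \<in> F \<Longrightarrow> ip (blinfun_apply A (blinfun_apply V x)) h = 0"
proof -
  obtain adj where adj: "\<And>x y. ip (blinfun_apply A x) y = ip x (adj y)"
    using adjoint_vector[OF b A(1)] by metis
  obtain c where c: "c > 0"
    "\<And>S. finite S \<Longrightarrow> \<exists>e. norm e = 1 \<and> (\<forall>s\<in>S. ip e s = 0) \<and> c \<le> norm (blinfun_apply A e)"
    using noncompact_lower_bound[OF A] by metis
  then obtain pick where pick: "\<And>S. finite S \<Longrightarrow> norm (pick S) = 1"
    "\<And>S s. finite S \<Longrightarrow> s \<in> S \<Longrightarrow> ip (pick S) s = 0"
    "\<And>S. finite S \<Longrightarrow> c \<le> norm (blinfun_apply A (pick S))"
    by metis
  \<comment> \<open>\<open>T n\<close> collects everything that the next vector must be orthogonal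
    to. Orthogonality to \<open>adj y\<close> means that its image under \<open>A\<close> is
    orthogonal to \<open>y\<close>, so \<open>adj\<close> handles both \<open>F\<close> and the
    earlier images.\<close>
  define T where "T = rec_nat (adj ` F) (\<lambda>_ S. S \<union> {pick S, adj (blinfun_apply A (pick S))})"
  have T0: "T 0 = adj ` F" and TS: "\<And>n. T (Suc n) = T n \<union> {pick (T n), adj (blinfun_apply A (pick (T n)))}"
    by (simp_all add: T_def)
  have fT: "finite (T n)" for n by (induction n) (simp_all add: T0 TS F)
  have mono: "i \<le> j \<Longrightarrow> T i \<subseteq> T j" for i j by (rule lift_Suc_mono_le) (auto simp: TS)
  define e where "e n = pick (T n)" for n
  define a where "a n = blinfun_apply A (e n)" for n
  have e1: "norm (e n) = 1" and ca: "c \<le> norm (a n)" for n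
    using pick fT by (simp_all add: e_def a_def)
  have na: "norm (a n) \<noteq> 0" for n using ca[of n] c(1) by linarith
  have e_in: "e i \<in> T j" "adj (a i) \<in> T j" if "i < j" for i j
    using mono[of "Suc i" j] that by (auto simp: TS e_def a_def)
  have eo: "orthogonal_seq e"
    using pick(2)[OF fT e_in(1)] by (intro orthogonal_seqI_less) (simp add: e_def)
  have ao: "orthogonal_seq a"
  proof (rule orthogonal_seqI_less)
    fix i j :: nat assume "i < j"
    then have "ip (e j) (adj (a i)) = 0" using pick(2)[OF fT e_in(2)] by (simp add: e_def)
    then show "ip (a j) (a i) = 0" by (subst a_def) (simp add: adj)
  qed
  have aF: "ip (a n) h = 0" if "h \<in> F" for n h
  proof -
    have "adj h \<in> T n" using that mono[of 0 n] by (auto simp: T0)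
    then show ?thesis using pick(2)[OF fT] by (simp add: a_def adj e_def)
  qed
  define u where "u n = smul (of_real (1 / norm (a n))) (a n)" for n
  \<comment> \<open>Along the unit vector \<open>u n\<close>, the image \<open>A (V x)\<close> has
    coefficient \<open>ip x (b n)\<close> times \<open>norm (a n)\<close>; the weight in
    \<open>w n\<close> cancels that norm.\<close>
  define w where "w n = smul (of_real (1 / norm (a n))) (b n)" for n
  have "orthogonal_seq u" unfolding u_def by (rule orthogonal_seq_smul[OF ao])
  then have u: "semi_orthonormal u"
    using na by (simp add: semi_orthonormal_def u_def norm_divide)
  have bo: "orthogonal_seq b" using b(1) by (simp add: semi_orthonormal_def)
  then have wo: "orthogonal_seq w" unfolding w_def by (rule orthogonal_seq_smul)
  have wn: "norm (w n) \<le> 1 / c" for n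
  proof -
    have "norm (w n) = (1 / norm (a n)) * norm (b n)" by (simp add: w_def norm_divide)
    also have "\<dots> \<le> (1 / c) * 1"
      using ca[of n] c(1) semi_orthonormal_norm_le[OF b(1)] by (intro mult_mono frac_le) auto
    finally show ?thesis by simp
  qed
  obtain V where V: "V \<in> bounded_ops smul" "\<And>x. (\<lambda>n. smul (ip x (b n)) (e n)) sums blinfun_apply V x"
    using series_operator[OF b(1) eo, of 1] e1 by auto
  obtain W where W: "W \<in> bounded_ops smul" "\<And>x. (\<lambda>n. smul (ip x (u n)) (w n)) sums blinfun_apply W x"
    using series_operator[OF u wo wn] by blast
  have AV: "(\<lambda>n. smul (ip x (b n)) (a n)) sums blinfun_apply A (blinfun_apply V x)" for x
    using bounded_linear.sums[OF blinfun.bounded_linear_right V(2), of A x]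
    by (simp add: bounded_opsD[OF A(1)] a_def)
  have ipAV: "(\<lambda>n. ip x (b n) * ip (a n) y) sums ip (blinfun_apply A (blinfun_apply V x)) y" for x y
    using bounded_linear.sums[OF bounded_linear_ip AV] by (simp add: ip_smul_left)
  show ?thesis
  proof (rule that[OF V(1) W(1)])
    show "ip (blinfun_apply A (blinfun_apply V x)) h = 0" if "h \<in> F" for h x
      using ipAV[of x h] aF[OF that] sums_unique2[OF sums_zero] by simp
    show "blinfun_apply W h = 0" if "h \<in> F" for h
    proof -
      have "ip h (u n) = 0" for n
        using aF[OF that, of n] by (simp add: u_def ip_smul_right ip_eq_0_commute)
      then show ?thesis using W(2)[of h] sums_unique2[OF sums_zero] by simp
    qed
    show "blinfun_apply W (blinfun_apply A (blinfun_apply V x)) = x" for x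
    proof -
      let ?y = "blinfun_apply A (blinfun_apply V x)"
      have "ip ?y (u m) = ip x (b m) * of_real (norm (a m))" for m
      proof -
        \<comment> \<open>Orthogonality of \<open>a\<close> leaves only the term
          \<open>n = m\<close>.\<close>
        have "(\<lambda>n. ip x (b n) * ip (a n) (a m)) sums (ip x (b m) * ip (a m) (a m))"
          using sums_finite[of "{m}" "\<lambda>n. ip x (b n) * ip (a n) (a m)"]
          by (simp add: orthogonal_seqD[OF ao])
        then have "ip ?y (a m) = ip x (b m) * ip (a m) (a m)"
          using ipAV sums_unique2 by blast
        then show ?thesis
          using na[of m] conj_of_real[of "1 / norm (a m)", where 'k='k]
          by (simp add: u_def ip_smul_right ip_self power2_eq_square)
      qed
      then have "smul (ip ?y (u m)) (w m) = smul (ip x (b m)) (b m)" for m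
        using na[of m] by (simp add: w_def)
      then show ?thesis using W(2)[of ?y] b(2)[of x] sums_unique2 by simp
    qed
  qed
qed

section \<open>Density\<close>

lemma bounded_ops_compose: "S \<in> bounded_ops smul \<Longrightarrow> T \<in> bounded_ops smul \<Longrightarrow> S o\<^sub>L T \<in> bounded_ops smul"
  by (simp add: bounded_ops_def)

lemma bounded_ops_add: "S \<in> bounded_ops smul \<Longrightarrow> T \<in> bounded_ops smul \<Longrightarrow> S + T \<in> bounded_ops smul"
  by (simp add: bounded_ops_def blinfun.add_left scale_right_distrib)

lemma bounded_ops_diff: "S \<in> bounded_ops smul \<Longrightarrow> T \<in> bounded_ops smul \<Longrightarrow> S - T \<in> bounded_ops smul"
  by (simp add: bounded_ops_def blinfun.diff_left scale_right_diff_distrib)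

lemma bounded_ops_scaleR_closed: "T \<in> bounded_ops smul \<Longrightarrow> r *\<^sub>R T \<in> bounded_ops smul"
  by (simp add: bounded_ops_def blinfun.scaleR_left mult.commute flip: smul_of_real)

lemma bounded_ops_id: "id_blinfun \<in> bounded_ops smul"
  by (simp add: bounded_ops_def)

lemmas bounded_ops_intros =
  bounded_ops_compose bounded_ops_add bounded_ops_diff bounded_ops_scaleR_closed bounded_ops_id

text \<open>\<open>V\<close> is fixed before \<delta>, so letting \<delta> tend to 0 makes the error
  in \<open>Y\<close> arbitrarily small at all points of \<open>S\<close>, while \<open>X\<close>
  has no error there.\<close>

lemma solutions_agreeing_on_finite_set:
  assumes sep: "separable_space (euclidean :: 'a topology)"
    and A: "A \<in> bounded_ops smul" "\<not> compact_operator A" and B: "B \<in> bounded_ops smul"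
    and X0: "X0 \<in> bounded_ops smul" and Y0: "Y0 \<in> bounded_ops smul" and S: "finite S"
  obtains V where "\<And>\<delta>. \<delta> > (0::real) \<Longrightarrow> \<exists>X Y. X \<in> bounded_ops smul \<and> Y \<in> bounded_ops smul \<and> X o\<^sub>L A o\<^sub>L Y = B \<and>
    (\<forall>x\<in>S. blinfun_apply X x = blinfun_apply X0 x \<and> blinfun_apply Y x = blinfun_apply Y0 x + \<delta> *\<^sub>R V x)"
proof -
  obtain b where b: "semi_orthonormal b" "\<And>x. (\<lambda>n. smul (ip x (b n)) (b n)) sums x"
    using semi_orthonormal_basis_exists[OF sep] by blast
  obtain P g and N :: nat where P: "P \<in> bounded_ops smul" and g: "semi_orthonormal g"
    and Px: "\<And>x. blinfun_apply P x = (\<Sum>i<N. smul (ip x (g i)) (g i))"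
    and PS: "\<And>s. s \<in> S \<Longrightarrow> blinfun_apply P s = s"
    by (rule finite_projection[OF S]) (rule that)
  \<comment> \<open>The first set forces \<open>W P = 0\<close> and \<open>P A V = 0\<close>, the
    second \<open>W A Y0 P = 0\<close>. These identities remove the cross terms of
    \<open>X A Y\<close>.\<close>
  define F where "F = g ` {..<N} \<union> (\<lambda>i. blinfun_apply A (blinfun_apply Y0 (g i))) ` {..<N}"
  have "finite F" by (simp add: F_def)
  then obtain V W where
    V: "V \<in> bounded_ops smul" and W: "W \<in> bounded_ops smul"
    and WAV: "\<And>x. blinfun_apply W (blinfun_apply A (blinfun_apply V x)) = x"
    and WF: "\<And>h. h \<in> F \<Longrightarrow> blinfun_apply W h = 0"
    and AVF: "\<And>h x. h \<in> F \<Longrightarrow> ip (blinfun_apply A (blinfun_apply V x)) h = 0"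
    by (rule noncompact_factors_identity[OF b A]) (rule that)
  have WP: "blinfun_apply W (blinfun_apply P x) = 0" for x
    unfolding Px blinfun.sum_right bounded_opsD[OF W] by (intro sum.neutral) (simp add: WF F_def)
  have WAYP: "blinfun_apply W (blinfun_apply A (blinfun_apply Y0 (blinfun_apply P x))) = 0" for x
    unfolding Px blinfun.sum_right bounded_opsD[OF W] bounded_opsD[OF A(1)] bounded_opsD[OF Y0]
    by (intro sum.neutral) (simp add: WF F_def)
  have PAV: "blinfun_apply P (blinfun_apply A (blinfun_apply V x)) = 0" for x
    unfolding Px by (intro sum.neutral) (simp add: AVF F_def)
  have PP: "blinfun_apply P (blinfun_apply P x) = blinfun_apply P x" for x
    by (subst Px, subst Px) (simp add: ip_semi_orthonormal_sum[OF g] Px)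
  show ?thesis
  proof (rule that[of "blinfun_apply V"])
    fix \<delta> :: real assume d: "0 < \<delta>"
    \<comment> \<open>\<open>D\<close> scales the range of \<open>P\<close> by \<delta> and fixes
      the kernel of \<open>P\<close>; \<open>D'\<close> inverts it. Thus \<open>V D\<close> perturbs
      \<open>Y\<close> only slightly on \<open>S\<close> without losing invertibility.\<close>
    define D where "D = id_blinfun - (1 - \<delta>) *\<^sub>R P"
    define D' where "D' = id_blinfun + (1 / \<delta> - 1) *\<^sub>R P"
    define Z where "Z = (B - (X0 o\<^sub>L P o\<^sub>L A o\<^sub>L Y0 o\<^sub>L P)) o\<^sub>L D'"
    define Y where "Y = (Y0 o\<^sub>L P) + (V o\<^sub>L D)"
    define X where "X = (X0 o\<^sub>L P) + (Z o\<^sub>L W)"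
    have mem: "X \<in> bounded_ops smul" "Y \<in> bounded_ops smul"
      unfolding X_def Y_def Z_def D'_def D_def
      by (intro bounded_ops_intros A(1) B X0 Y0 P V W)+
    have DD: "blinfun_apply D' (blinfun_apply D x) = x" for x
    proof -
      have "blinfun_apply D' (blinfun_apply D x)
          = x - (1 - \<delta>) *\<^sub>R blinfun_apply P x + (1 / \<delta> - 1) *\<^sub>R (blinfun_apply P x - (1 - \<delta>) *\<^sub>R blinfun_apply P x)"
        by (simp add: D_def D'_def blinfun.bilinear_simps PP algebra_simps)
      also have "\<dots> = x + ((1 / \<delta> - 1) * \<delta> - (1 - \<delta>)) *\<^sub>R blinfun_apply P x"
        by (simp add: algebra_simps)
      also have "(1 / \<delta> - 1) * \<delta> - (1 - \<delta>) = 0" using d by (simp add: field_simps)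
      finally show ?thesis by simp
    qed
    \<comment> \<open>Of the four products, \<open>X0 P A Y0 P\<close> and
      \<open>Z W A V D = Z D\<close> survive, and \<open>Z\<close> was chosen so that they add up to
      \<open>B\<close>.\<close>
    have "blinfun_apply (X o\<^sub>L A o\<^sub>L Y) x = blinfun_apply B x" for x
      by (simp add: X_def Y_def Z_def blinfun.bilinear_simps WAV WAYP PAV DD)
    then have "X o\<^sub>L A o\<^sub>L Y = B" by (rule blinfun_eqI)
    moreover have "blinfun_apply X x = blinfun_apply X0 x \<and> blinfun_apply Y x = blinfun_apply Y0 x + \<delta> *\<^sub>R blinfun_apply V x"
      if "x \<in> S" for x
    proof
      have "blinfun_apply W x = 0" using WP[of x] PS[OF that] by simp
      then show "blinfun_apply X x = blinfun_apply X0 x"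
        by (simp add: X_def blinfun.bilinear_simps PS[OF that])
      have "blinfun_apply D x = \<delta> *\<^sub>R x"
        by (simp add: D_def blinfun.bilinear_simps PS[OF that] algebra_simps)
      then show "blinfun_apply Y x = blinfun_apply Y0 x + \<delta> *\<^sub>R blinfun_apply V x"
        by (simp add: Y_def blinfun.bilinear_simps PS[OF that])
    qed
    ultimately show "\<exists>X Y. X \<in> bounded_ops smul \<and> Y \<in> bounded_ops smul \<and> X o\<^sub>L A o\<^sub>L Y = B \<and>
      (\<forall>x\<in>S. blinfun_apply X x = blinfun_apply X0 x \<and> blinfun_apply Y x = blinfun_apply Y0 x + \<delta> *\<^sub>R blinfun_apply V x)"
      using mem by blast
  qed
qed

end

section \<open>Basic neighbourhoods in the strong operator topology, and the density theorem\<close>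

lemma topspace_sot: "topspace (sot smul) = bounded_ops smul"
  by (simp add: sot_def strong_operator_topology_topspace)

text \<open>The strong operator topology is pulled back from the product topology on functions,
  where a basic open set restricts only finitely many coordinates; these form
  \<open>S\<close>.\<close>

lemma sot_open_contains_basis:
  assumes "openin (sot smul) U" "T0 \<in> U"
  obtains S G where "finite S" "\<And>x. open (G x)" "\<And>x. blinfun_apply T0 x \<in> G x"
    "\<And>T. T \<in> bounded_ops smul \<Longrightarrow> \<forall>x\<in>S. blinfun_apply T x \<in> G x \<Longrightarrow> T \<in> U"
proof -
  obtain U' where U': "openin strong_operator_topology U'" "U = U' \<inter> bounded_ops smul"
    using assms(1) by (auto simp: sot_def openin_subtopology)
  obtain Q where Q: "open Q" "U' = blinfun_apply -` Q"
    using U'(1) by (auto simp: strong_operator_topology_def openin_pullback_topology)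
  have "openin (product_topology (\<lambda>i. euclidean) UNIV) Q" "blinfun_apply T0 \<in> Q"
    using Q U'(2) assms(2) by (auto simp: open_fun_def)
  from product_topology_open_contains_basis[OF this]
  obtain G where "blinfun_apply T0 \<in> (\<Pi>\<^sub>E i\<in>UNIV. G i)" "\<And>i. openin euclidean (G i)"
    "finite {i. G i \<noteq> topspace euclidean}" "(\<Pi>\<^sub>E i\<in>UNIV. G i) \<subseteq> Q"
    by blast
  then have G: "\<And>x. blinfun_apply T0 x \<in> G x" "\<And>i. open (G i)" "finite {i. G i \<noteq> UNIV}"
    "\<And>f. (\<And>x. f x \<in> G x) \<Longrightarrow> f \<in> Q"
    by (auto simp: PiE_UNIV_domain)
  show ?thesis
  proof (rule that[OF G(3,2,1)])
    fix T assume "T \<in> bounded_ops smul" and T: "\<forall>x\<in>{i. G i \<noteq> UNIV}. blinfun_apply T x \<in> G x"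
    then show "T \<in> U" using G(4)[of "blinfun_apply T"] unfolding U'(2) Q(2) by blast
  qed
qed

theorem theorem8p10:
  fixes smul :: "'k::real_complex_field \<Rightarrow> 'a::banach \<Rightarrow> 'a"
    and ip :: "'a \<Rightarrow> 'a \<Rightarrow> 'k"
    and A B :: "'a \<Rightarrow>\<^sub>L 'a"
  assumes "hilbert_space smul ip"
    and "separable_space (euclidean :: 'a topology)"
    and "A \<in> bounded_ops smul"
    and "\<not> compact_operator A"
    and "B \<in> bounded_ops smul"
  shows "prod_topology (sot smul) (sot smul) closure_of
           {(X, Y). X \<in> bounded_ops smul \<and> Y \<in> bounded_ops smul \<and> X o\<^sub>L A o\<^sub>L Y = B}
         = bounded_ops smul \<times> bounded_ops smul"
    (is "?\<tau> closure_of ?sol = _")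
proof
  interpret hilbert_space smul ip by fact
  have ts: "topspace ?\<tau> = bounded_ops smul \<times> bounded_ops smul" by (simp add: topspace_sot)
  show "?\<tau> closure_of ?sol \<subseteq> bounded_ops smul \<times> bounded_ops smul"
    using closure_of_subset_topspace[of ?\<tau> ?sol] unfolding ts .
  show "bounded_ops smul \<times> bounded_ops smul \<subseteq> ?\<tau> closure_of ?sol"
  proof
    fix p assume p: "p \<in> bounded_ops smul \<times> bounded_ops smul"
    then obtain X0 Y0 where p_eq: "p = (X0, Y0)" and X0: "X0 \<in> bounded_ops smul" and Y0: "Y0 \<in> bounded_ops smul"
      by blast
    have "\<exists>q. q \<in> ?sol \<and> q \<in> U" if U: "p \<in> U" "openin ?\<tau> U" for U
    proof -
      obtain U1 U2 where U12: "openin (sot smul) U1" "openin (sot smul) U2" "X0 \<in> U1" "Y0 \<in> U2" "U1 \<times> U2 \<subseteq> U"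
        using U unfolding p_eq openin_prod_topology_alt by meson
      obtain S1 G1 where 1: "finite S1" "\<And>x. open (G1 x)" "\<And>x. blinfun_apply X0 x \<in> G1 x"
        "\<And>T. T \<in> bounded_ops smul \<Longrightarrow> \<forall>x\<in>S1. blinfun_apply T x \<in> G1 x \<Longrightarrow> T \<in> U1"
        by (rule sot_open_contains_basis[OF U12(1,3)]) (rule that)
      obtain S2 G2 where 2: "finite S2" "\<And>x. open (G2 x)" "\<And>x. blinfun_apply Y0 x \<in> G2 x"
        "\<And>T. T \<in> bounded_ops smul \<Longrightarrow> \<forall>x\<in>S2. blinfun_apply T x \<in> G2 x \<Longrightarrow> T \<in> U2"
        by (rule sot_open_contains_basis[OF U12(2,4)]) (rule that)
      \<comment> \<open>One finite set serves both components, so a single pair of solutions meets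
        both neighbourhoods.\<close>
      have "finite (S1 \<union> S2)" using 1(1) 2(1) by simp
      then obtain V where
        V: "\<And>\<delta>. \<delta> > (0::real) \<Longrightarrow> \<exists>X Y. X \<in> bounded_ops smul \<and> Y \<in> bounded_ops smul \<and> X o\<^sub>L A o\<^sub>L Y = B \<and>
          (\<forall>x\<in>S1 \<union> S2. blinfun_apply X x = blinfun_apply X0 x \<and> blinfun_apply Y x = blinfun_apply Y0 x + \<delta> *\<^sub>R V x)"
        by (rule solutions_agreeing_on_finite_set[OF assms(2-5) X0 Y0]) (rule that)
      have "\<forall>\<^sub>F \<delta> in at_right 0. blinfun_apply Y0 x + \<delta> *\<^sub>R V x \<in> G2 x" for x
      proof (rule topological_tendstoD[OF _ 2(2)])
        have "((\<lambda>\<delta>. blinfun_apply Y0 x + \<delta> *\<^sub>R V x) \<longlongrightarrow> blinfun_apply Y0 x + 0 *\<^sub>R V x) (at_right 0)"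
          by (intro tendsto_intros)
        then show "((\<lambda>\<delta>. blinfun_apply Y0 x + \<delta> *\<^sub>R V x) \<longlongrightarrow> blinfun_apply Y0 x) (at_right 0)" by simp
      qed (rule 2(3))
      \<comment> \<open>Finitely many points allow one \<delta> for all of them; the filter from the
        right supplies its positivity.\<close>
      then have "\<forall>\<^sub>F \<delta> in at_right 0. \<forall>x\<in>S2. blinfun_apply Y0 x + \<delta> *\<^sub>R V x \<in> G2 x"
        using 2(1) by (intro eventually_ball_finite) auto
      with eventually_at_right_less[of "0::real"]
      have "\<forall>\<^sub>F \<delta> in at_right 0. 0 < \<delta> \<and> (\<forall>x\<in>S2. blinfun_apply Y0 x + \<delta> *\<^sub>R V x \<in> G2 x)"
        by (rule eventually_conj)
      from eventually_happens'[OF _ this]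
      obtain \<delta> where d: "0 < \<delta>" "\<And>x. x \<in> S2 \<Longrightarrow> blinfun_apply Y0 x + \<delta> *\<^sub>R V x \<in> G2 x"
        by auto
      from V[OF d(1)] obtain X Y where XY: "X \<in> bounded_ops smul" "Y \<in> bounded_ops smul" "X o\<^sub>L A o\<^sub>L Y = B"
        "\<And>x. x \<in> S1 \<union> S2 \<Longrightarrow> blinfun_apply X x = blinfun_apply X0 x"
        "\<And>x. x \<in> S1 \<union> S2 \<Longrightarrow> blinfun_apply Y x = blinfun_apply Y0 x + \<delta> *\<^sub>R V x"
        by blast
      have "X \<in> U1" using 1(3) XY by (intro 1(4)) auto
      moreover have "Y \<in> U2" using d(2) XY by (intro 2(4)) auto
      ultimately show ?thesis using U12(5) XY by blast
    qed
    then show "p \<in> ?\<tau> closure_of ?sol"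
      unfolding in_closure_of ts using p by blast
  qed
qed

end
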